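(* Let $n\ge 4$ and let $\mathbb{F}$ be a field with at least $n$ pairwise different elements. The set of invariants $$\sigma_t(F),\;\zeta(F),\quad\text{where } 1\le t\le n \text{ and } F\in \mathrm{alg}_{\mathbb{F}}\{X\}_2,$$ does not separate $\mathrm{GL}_n$-orbits on $D_n$; that is, there exist $\underline{A},\underline{B}\in D_n$ with $\mathrm{GL}_n\cdot\underline{A}\ne\mathrm{GL}_n\cdot\underline{B}$ such that $\sigma_t(F(\underline{A}))=\sigma_t(F(\underline{B}))$ and $\zeta(F(\underline{A}))=\zeta(F(\underline{B}))$ for all $1\le t\le n$ and all $F\in\mathrm{alg}_{\mathbb{F}}\{X\}_2$. In particular, the set $\mathrm{Set}_{\sigma}\cup\mathrm{Set}_{\zeta}$, where $\mathrm{Set}_{\sigma}=\{\sigma_t(X_1)\,|\,1\le t\le n\}$ and $\mathrm{Set}_{\zeta}=\{\zeta(F)\,|\,F\in \mathrm{alg}_{\mathbb{F}}\{X\}_2 \text{ has degree less than or equal to } 2n-1\}$, does not separate $\mathrm{GL}_n$-orbits on $D_n$.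
   Context: $\mathbb{F}$ is a field (possibly finite, of arbitrary characteristic). $M_n$ is the space of $n\times n$ matrices over $\mathbb{F}$, and $\mathrm{GL}_n=\mathrm{GL}_n(\mathbb{F})$ acts on $M_n^2$ by simultaneous conjugation: $g\cdot(A_1,A_2)=(gA_1g^{-1},gA_2g^{-1})$. $D_n\subset M_n^2$ is the set of all pairs $\underline{A}=(A_1,A_2)$ such that $A_1$ has $n$ distinct eigenvalues in $\mathbb{F}$; it is $\mathrm{GL}_n$-invariant. A set $S$ of $\mathrm{GL}_n$-invariant functions on $M_n^2$ separates $\mathrm{GL}_n$-orbits on $D_n$ if for all $\underline{A},\underline{B}\in D_n$ the condition $f(\underline{A})=f(\underline{B})$ for all $f\in S$ implies $\mathrm{GL}_n\cdot\underline{A}=\mathrm{GL}_n\cdot\underline{B}$. For $k=1,2$, $X_k=(x_{ij}(k))_{1\le i,j\le n}$ is the generic $n\times n$ matrix whose entries are independent commuting variables, and $\mathrm{alg}_{\mathbb{F}}\{X\}_2$ is the associative $\mathbb{F}$-algebra generated by $X_1,X_2$ and the identity matrix $I_n$. For $F\in \mathrm{alg}_{\mathbb{F}}\{X\}_2$ and $\underline{A}\in M_n^2$, $F(\underline{A})\in M_n$ is the result of substituting $X_k\mapsto A_k$. The degree of $F$ is the minimal degree of a non-commutative polynomial $f$ in letters $x_1,x_2$ over $\mathbb{F}$ such that $F=f(X_1,X_2)$. $\sigma_t$ denotes the $t$-th coefficient of the characteristic polynomial of an $n\times n$ matrix ($\sigma_1=\mathrm{tr}$, ..., $\sigma_n=\det$),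 and $\sigma_t(F)$ is the function $\underline{A}\mapsto\sigma_t(F(\underline{A}))$. The function $\zeta:M_n\to\mathbb{F}$ is $\zeta(A)=1$ if $A=0$ and $\zeta(A)=0$ if $A\ne0$; $\zeta(F)$ is the function $\underline{A}\mapsto\zeta(F(\underline{A}))$. *)

theory Defs
  imports "Jordan_Normal_Form.Char_Poly" "HOL-Library.Poly_Mapping"
begin

text \<open>
  An \<open>n \<times> n\<close> matrix is an element of \<^term>\<open>carrier_mat n n\<close>, so row and column
  indices run over \<open>{0..<n}\<close>.
\<close>

type_synonym 'a mat_pair = "'a mat \<times> 'a mat"

datatype letter = L1 | L2

fun component :: "'a mat_pair \<Rightarrow> letter \<Rightarrow> 'a mat" where
  "component A L1 = fst A"
| "component A L2 = snd A"


subsection \<open>Simultaneous conjugation\<close>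

definition mat_pairs :: "nat \<Rightarrow> 'a mat_pair set" where
  "mat_pairs n = carrier_mat n n \<times> carrier_mat n n"

text \<open>In the following, \<open>h\<close> is the inverse of \<open>g\<close>.\<close>

definition GL_orbit :: "nat \<Rightarrow> 'a::field mat_pair \<Rightarrow> 'a mat_pair set" where
  "GL_orbit n A = {(g * fst A * h, g * snd A * h) | g h.
     g \<in> carrier_mat n n \<and> h \<in> carrier_mat n n \<and> inverts_mat g h \<and> inverts_mat h g}"

definition D_set :: "nat \<Rightarrow> 'a::field mat_pair set" where
  "D_set n = {A \<in> mat_pairs n. card {k. eigenvalue (fst A) k} = n}"

definition separates_GL_orbits ::
    "nat \<Rightarrow> ('a::field mat_pair \<Rightarrow> 'a) set \<Rightarrow> 'a mat_pair set \<Rightarrow> bool" where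
  "separates_GL_orbits n S D \<longleftrightarrow>
     (\<forall>A\<in>D. \<forall>B\<in>D. (\<forall>f\<in>S. f A = f B) \<longrightarrow> GL_orbit n A = GL_orbit n B)"


subsection \<open>Generic matrices\<close>

text \<open>
  Commutative polynomials over \<open>'a\<close> in the variables \<open>x\<^sub>i\<^sub>j(k)\<close>: a monomial is a finitely
  supported exponent function, a polynomial a finitely supported coefficient function on
  monomials. The variable \<open>x\<^sub>i\<^sub>j(k)\<close> is the triple \<open>(k, i, j)\<close>.
\<close>

type_synonym gvar = "letter \<times> nat \<times> nat"
type_synonym 'a gpoly = "(gvar \<Rightarrow>\<^sub>0 nat) \<Rightarrow>\<^sub>0 'a"

definition gvar_poly :: "gvar \<Rightarrow> 'a::field gpoly" where
  "gvar_poly v = Poly_Mapping.single (Poly_Mapping.single v 1) 1"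

definition gconst :: "'a::field \<Rightarrow> 'a gpoly" where
  "gconst c = Poly_Mapping.single 0 c"

definition gpoly_eval :: "(gvar \<Rightarrow> 'a::field) \<Rightarrow> 'a gpoly \<Rightarrow> 'a" where
  "gpoly_eval a p = (\<Sum>m\<in>Poly_Mapping.keys p. Poly_Mapping.lookup p m *
      (\<Prod>v\<in>Poly_Mapping.keys m. a v ^ Poly_Mapping.lookup m v))"

definition generic_mat :: "nat \<Rightarrow> letter \<Rightarrow> 'a::field gpoly mat" where
  "generic_mat n k = mat n n (\<lambda>(i, j). gvar_poly (k, i, j))"

inductive_set alg_X :: "nat \<Rightarrow> 'a::field gpoly mat set" for n where
  one: "1\<^sub>m n \<in> alg_X n"
| generic: "generic_mat n k \<in> alg_X n"
| add: "F \<in> alg_X n \<Longrightarrow> G \<in> alg_X n \<Longrightarrow> F + G \<in> alg_X n"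
| smult: "F \<in> alg_X n \<Longrightarrow> gconst c \<cdot>\<^sub>m F \<in> alg_X n"
| mult: "F \<in> alg_X n \<Longrightarrow> G \<in> alg_X n \<Longrightarrow> F * G \<in> alg_X n"

definition subst_mat :: "'a::field gpoly mat \<Rightarrow> 'a mat_pair \<Rightarrow> 'a mat" where
  "subst_mat F A = map_mat (gpoly_eval (\<lambda>(k, i, j). component A k $$ (i, j))) F"


subsection \<open>Degree\<close>

text \<open>
  A non-commutative polynomial is a finitely supported coefficient function on words. Its
  degree is the maximal length of a word in its support; the zero polynomial gets degree 0.
\<close>

type_synonym 'a ncpoly = "letter list \<Rightarrow>\<^sub>0 'a"

definition nc_degree :: "'a::field ncpoly \<Rightarrow> nat" where
  "nc_degree f = Max (insert 0 (length ` Poly_Mapping.keys f))"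

definition word_mat :: "nat \<Rightarrow> letter list \<Rightarrow> 'a::field gpoly mat" where
  "word_mat n w = foldr (\<lambda>k M. generic_mat n k * M) w (1\<^sub>m n)"

text \<open>
  The linear combination of the matrices \<open>word_mat n w\<close> is formed entrywise, since matrices of
  unspecified dimension have no additive unit over which \<open>sum\<close> could range.
\<close>

definition nc_eval :: "nat \<Rightarrow> 'a::field ncpoly \<Rightarrow> 'a gpoly mat" where
  "nc_eval n f = mat n n (\<lambda>ij.
     \<Sum>w\<in>Poly_Mapping.keys f. gconst (Poly_Mapping.lookup f w) * word_mat n w $$ ij)"

definition alg_degree :: "nat \<Rightarrow> 'a::field gpoly mat \<Rightarrow> nat" where
  "alg_degree n F = (LEAST d. \<exists>f. nc_eval n f = F \<and> nc_degree f = d)"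


subsection \<open>The invariants\<close>

text \<open>
  \<^const>\<open>char_poly\<close> is \<open>det (x I - A) = \<Sum>t\<le>n. (- 1) ^ t * \<sigma>\<^sub>t(A) * x ^ (n - t)\<close>; the sign makes
  \<open>\<sigma>\<^sub>1\<close> the trace and \<open>\<sigma>\<^sub>n\<close> the determinant.
\<close>

definition sigma :: "nat \<Rightarrow> 'a::field mat \<Rightarrow> 'a" where
  "sigma t A = (- 1) ^ t * coeff (char_poly A) (dim_row A - t)"

definition zeta :: "'a::field mat \<Rightarrow> 'a" where
  "zeta A = (if A = 0\<^sub>m (dim_row A) (dim_col A) then 1 else 0)"

definition sigma_inv :: "nat \<Rightarrow> 'a::field gpoly mat \<Rightarrow> 'a mat_pair \<Rightarrow> 'a" where
  "sigma_inv t F = (\<lambda>A. sigma t (subst_mat F A))"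

definition zeta_inv :: "'a::field gpoly mat \<Rightarrow> 'a mat_pair \<Rightarrow> 'a" where
  "zeta_inv F = (\<lambda>A. zeta (subst_mat F A))"

definition all_sigma_zeta :: "nat \<Rightarrow> ('a::field mat_pair \<Rightarrow> 'a) set" where
  "all_sigma_zeta n =
     {sigma_inv t F | t F. t \<in> {1..n} \<and> F \<in> alg_X n} \<union> {zeta_inv F | F. F \<in> alg_X n}"

definition Set_sigma :: "nat \<Rightarrow> ('a::field mat_pair \<Rightarrow> 'a) set" where
  "Set_sigma n = {sigma_inv t (generic_mat n L1) | t. t \<in> {1..n}}"

definition Set_zeta :: "nat \<Rightarrow> ('a::field mat_pair \<Rightarrow> 'a) set" where
  "Set_zeta n = {zeta_inv F | F. F \<in> alg_X n \<and> alg_degree n F \<le> 2 * n - 1}"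

end

theory Submission
  imports Defs
begin

text \<open>
  Let \<open>A\<^sub>1\<close> be diagonal with distinct entries, and let \<open>A\<^sub>2\<close> be supported on the positions
  \<open>(0,2), (0,3), (1,2), (1,3)\<close>. In the graph of these positions no two edges can be composed,
  so an entry of \<open>F(A)\<close> on one of these positions is the entry of \<open>A\<^sub>2\<close> times a factor
  that depends only on \<open>F\<close> and \<open>A\<^sub>1\<close>, and the diagonal depends only on \<open>F\<close> and \<open>A\<^sub>1\<close>. Hence
  neither \<open>\<sigma>\<^sub>t\<close> nor \<open>\<zeta>\<close> sees the values of the nonzero entries of \<open>A\<^sub>2\<close>. The stabilizer of
  \<open>A\<^sub>1\<close> is the diagonal torus, under which the cross-ratio \<open>a\<^sub>0\<^sub>2 a\<^sub>1\<^sub>3 / (a\<^sub>0\<^sub>3 a\<^sub>1\<^sub>2)\<close> is invariant.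
\<close>

section \<open>Evaluation of commutative polynomials is a semiring homomorphism\<close>

definition monom_eval :: "('b \<Rightarrow> 'a::comm_semiring_1) \<Rightarrow> ('b \<Rightarrow>\<^sub>0 nat) \<Rightarrow> 'a" where
  "monom_eval a m = (\<Prod>v\<in>Poly_Mapping.keys m. a v ^ Poly_Mapping.lookup m v)"

text \<open>Variables with exponent 0 contribute a factor 1. Two monomials can thus be evaluated
  over one common index set.\<close>

lemma monom_eval_superset:
  assumes "finite S" "Poly_Mapping.keys m \<subseteq> S"
  shows "monom_eval a m = (\<Prod>v\<in>S. a v ^ Poly_Mapping.lookup m v)"
  unfolding monom_eval_def using assms
  by (intro prod.mono_neutral_left) (auto simp: in_keys_iff)

lemma monom_eval_0 [simp]: "monom_eval a 0 = 1"
  by (simp add: monom_eval_def)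

lemma monom_eval_add: "monom_eval a (m + m') = monom_eval a m * monom_eval a m'"
proof -
  let ?S = "Poly_Mapping.keys m \<union> Poly_Mapping.keys m'"
  have "monom_eval a (m + m') = (\<Prod>v\<in>?S. a v ^ Poly_Mapping.lookup (m + m') v)"
    by (rule monom_eval_superset) (simp_all add: Poly_Mapping.keys_add)
  also have "\<dots> = (\<Prod>v\<in>?S. a v ^ Poly_Mapping.lookup m v)
      * (\<Prod>v\<in>?S. a v ^ Poly_Mapping.lookup m' v)"
    by (simp add: lookup_add power_add prod.distrib)
  also have "\<dots> = monom_eval a m * monom_eval a m'"
    by (simp add: monom_eval_superset[of ?S])
  finally show ?thesis .
qed

lemma gpoly_eval_superset:
  assumes "finite S" "Poly_Mapping.keys p \<subseteq> S"
  shows "gpoly_eval a p = (\<Sum>m\<in>S. Poly_Mapping.lookup p m * monom_eval a m)"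
  unfolding gpoly_eval_def monom_eval_def[symmetric] using assms
  by (intro sum.mono_neutral_left) (auto simp: in_keys_iff)

lemma gpoly_eval_0: "gpoly_eval a 0 = 0"
  by (simp add: gpoly_eval_def)

lemma gpoly_eval_add: "gpoly_eval a (p + q) = gpoly_eval a p + gpoly_eval a q"
proof -
  let ?S = "Poly_Mapping.keys p \<union> Poly_Mapping.keys q"
  have "gpoly_eval a (p + q) = (\<Sum>m\<in>?S. Poly_Mapping.lookup (p + q) m * monom_eval a m)"
    by (rule gpoly_eval_superset) (simp_all add: Poly_Mapping.keys_add)
  also have "\<dots> = gpoly_eval a p + gpoly_eval a q"
    by (simp add: gpoly_eval_superset[of ?S] lookup_add distrib_right sum.distrib)
  finally show ?thesis .
qed

lemma gpoly_eval_sum: "gpoly_eval a (sum f S) = (\<Sum>i\<in>S. gpoly_eval a (f i))"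
  by (induction S rule: infinite_finite_induct) (simp_all add: gpoly_eval_0 gpoly_eval_add)

lemma gpoly_eval_single: "gpoly_eval a (Poly_Mapping.single m c) = c * monom_eval a m"
  by (subst gpoly_eval_superset[of "{m}"]) auto

lemma poly_mapping_sum_singles:
  fixes p :: "'b \<Rightarrow>\<^sub>0 'c::comm_monoid_add"
  shows "p = (\<Sum>m\<in>Poly_Mapping.keys p. Poly_Mapping.single m (Poly_Mapping.lookup p m))"
  by (rule poly_mapping_eqI)
    (auto simp: lookup_sum lookup_single when_def in_keys_iff sum.delta)

text \<open>Writing both factors as sums of single terms reduces the claim to
  \<open>mult_single\<close> and \<open>monom_eval_add\<close>.\<close>

lemma gpoly_eval_mult: "gpoly_eval a (p * q) = gpoly_eval a p * gpoly_eval a q"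
proof -
  let ?p = "\<lambda>m. Poly_Mapping.single m (Poly_Mapping.lookup p m)"
  let ?q = "\<lambda>m. Poly_Mapping.single m (Poly_Mapping.lookup q m)"
  have "p * q = (\<Sum>m\<in>Poly_Mapping.keys p. ?p m) * (\<Sum>m\<in>Poly_Mapping.keys q. ?q m)"
    using poly_mapping_sum_singles[of p] poly_mapping_sum_singles[of q] by simp
  also have "gpoly_eval a \<dots> = (\<Sum>m\<in>Poly_Mapping.keys p. \<Sum>m'\<in>Poly_Mapping.keys q.
      (Poly_Mapping.lookup p m * monom_eval a m) * (Poly_Mapping.lookup q m' * monom_eval a m'))"
    by (simp add: sum_product gpoly_eval_sum mult_single gpoly_eval_single monom_eval_add
        mult.assoc mult.left_commute)
  also have "\<dots> = gpoly_eval a p * gpoly_eval a q"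
    by (simp add: gpoly_eval_superset[OF finite_keys order_refl] sum_product)
  finally show ?thesis .
qed

lemma gpoly_eval_gconst [simp]: "gpoly_eval a (gconst c) = c"
  by (simp add: gconst_def gpoly_eval_single)

lemma gpoly_eval_1: "gpoly_eval a 1 = 1"
  by (simp flip: single_one add: gpoly_eval_single)

lemma gpoly_eval_gvar_poly [simp]: "gpoly_eval a (gvar_poly v) = a v"
  by (simp add: gvar_poly_def gpoly_eval_single monom_eval_def)

text \<open>Gives access to the facts on entrywise homomorphisms of matrices, for the unit and for
  products.\<close>

lemma semiring_hom_gpoly_eval: "semiring_hom (gpoly_eval a)"
  by unfold_locales (simp_all add: gpoly_eval_0 gpoly_eval_1 gpoly_eval_add gpoly_eval_mult)

section \<open>Substitution of a pair into the generic matrices\<close>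

lemma alg_X_carrier: "F \<in> alg_X n \<Longrightarrow> F \<in> carrier_mat n n"
  by (induction rule: alg_X.induct) (auto simp: generic_mat_def)

lemma subst_mat_one: "subst_mat (1\<^sub>m n) A = 1\<^sub>m n"
  unfolding subst_mat_def by (rule semiring_hom.mat_hom_one[OF semiring_hom_gpoly_eval])

lemma subst_mat_generic:
  "component A k \<in> carrier_mat n n \<Longrightarrow> subst_mat (generic_mat n k) A = component A k"
  by (rule eq_matI) (auto simp: subst_mat_def generic_mat_def)

lemma subst_mat_add:
  "F \<in> carrier_mat n n \<Longrightarrow> G \<in> carrier_mat n n \<Longrightarrow>
    subst_mat (F + G) A = subst_mat F A + subst_mat G A"
  by (rule eq_matI) (auto simp: subst_mat_def gpoly_eval_add)

lemma subst_mat_smult: "subst_mat (gconst c \<cdot>\<^sub>m F) A = c \<cdot>\<^sub>m subst_mat F A"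
  by (rule eq_matI) (auto simp: subst_mat_def gpoly_eval_mult)

lemma subst_mat_mult:
  "F \<in> carrier_mat n n \<Longrightarrow> G \<in> carrier_mat n n \<Longrightarrow>
    subst_mat (F * G) A = subst_mat F A * subst_mat G A"
  unfolding subst_mat_def by (rule semiring_hom.mat_hom_mult[OF semiring_hom_gpoly_eval])

section \<open>The pairs and the shape of the values of \<open>F\<close> on them\<close>

definition crown :: "'a::field \<Rightarrow> nat \<Rightarrow> nat \<Rightarrow> 'a" where
  "crown x i j = (if i < 2 \<and> 2 \<le> j \<and> j < 4 then if i = 1 \<and> j = 3 then x else 1 else 0)"

text \<open>As an undirected graph the support of the second matrix is a 4-cycle. Three of its
  entries are normalized to 1, so the cross-ratio equals \<open>x\<close>.\<close>

definition crown_pair :: "nat \<Rightarrow> (nat \<Rightarrow> 'a) \<Rightarrow> 'a::field \<Rightarrow> 'a mat_pair" where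
  "crown_pair n l x =
    (mat n n (\<lambda>(i, j). if i = j then l i else 0), mat n n (\<lambda>(i, j). crown x i j))"

text \<open>Carries all dependence on \<open>x\<close>. The diagonal is 1 so that a single
  coefficient function \<open>C\<close> describes both the diagonal and the edges.\<close>

definition crown_mask :: "'a::field \<Rightarrow> nat \<Rightarrow> nat \<Rightarrow> 'a" where
  "crown_mask x i j = (if i = j then 1 else crown x i j)"

definition crown_mat :: "nat \<Rightarrow> (nat \<Rightarrow> nat \<Rightarrow> 'a) \<Rightarrow> 'a::field \<Rightarrow> 'a mat" where
  "crown_mat n C x = mat n n (\<lambda>(i, j). C i j * crown_mask x i j)"

lemma crown_mat_carrier [simp]: "crown_mat n C x \<in> carrier_mat n n"
  by (simp add: crown_mat_def)

text \<open>Both factors would have to be edges, but edges end in 2 or 3 and start in 0 or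
  1.\<close>

lemma crown_mask_mult_eq_0:
  "k \<noteq> i \<Longrightarrow> k \<noteq> j \<Longrightarrow> crown_mask x i k * crown_mask x k j = 0"
  by (auto simp: crown_mask_def crown_def)

lemma crown_mat_mult:
  fixes C D :: "nat \<Rightarrow> nat \<Rightarrow> 'a::field"
  shows "crown_mat n C x * crown_mat n D x =
    crown_mat n (\<lambda>i j. if i = j then C i i * D i i else C i i * D i j + C i j * D j j) x"
proof (rule eq_matI)
  fix i j
  let ?f = "\<lambda>k. (C i k * D k j) * (crown_mask x i k * crown_mask x k j)"
  let ?R = "crown_mat n (\<lambda>i j. if i = j then C i i * D i i else C i i * D i j + C i j * D j j) x"
  assume "i < dim_row ?R" "j < dim_col ?R"
  hence ij: "i < n" "j < n" by (auto simp: crown_mat_def)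
  hence "(crown_mat n C x * crown_mat n D x) $$ (i, j) = (\<Sum>k<n. ?f k)"
    by (simp add: crown_mat_def scalar_prod_def mult_ac lessThan_atLeast0)
  \<comment> \<open>For \<open>i = j\<close> this set has one element, hence the case distinction in
    the coefficients of the product.\<close>
  also have "\<dots> = (\<Sum>k\<in>{i, j}. ?f k)"
    using ij by (intro sum.mono_neutral_right) (auto simp: crown_mask_mult_eq_0)
  also have "\<dots> = ?R $$ (i, j)"
    using ij by (auto simp: crown_mat_def crown_mask_def algebra_simps)
  finally show "(crown_mat n C x * crown_mat n D x) $$ (i, j) = ?R $$ (i, j)" .
qed (auto simp: crown_mat_def)

text \<open>The order of the quantifiers matters: one \<open>C\<close> serves all \<open>x\<close>.
  Matrices of the form \<open>crown_mat n C x\<close> are closed under the operations of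
  \<open>alg_X\<close>, with new coefficients free of \<open>x\<close>.\<close>

lemma subst_mat_crown_pair:
  assumes "F \<in> alg_X n"
  shows "\<exists>C. \<forall>x. subst_mat F (crown_pair n l x) = crown_mat n C x"
  using assms
proof (induction rule: alg_X.induct)
  case one
  have "\<forall>x. subst_mat (1\<^sub>m n) (crown_pair n l x) = crown_mat n (\<lambda>i j. if i = j then 1 else 0) x"
    by (auto simp: subst_mat_one crown_mat_def crown_mask_def)
  thus ?case by blast
next
  case (generic k)
  let ?C = "\<lambda>i j. case k of L1 \<Rightarrow> if i = j then l i else 0 | L2 \<Rightarrow> if i = j then 0 else 1"
  have "subst_mat (generic_mat n k) (crown_pair n l x) = crown_mat n ?C x" for x
    by (subst subst_mat_generic; cases k)
      (auto simp: crown_pair_def crown_mat_def crown_mask_def crown_def)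
  thus ?case by blast
next
  case (add F G)
  then obtain C D where "\<And>x. subst_mat F (crown_pair n l x) = crown_mat n C x"
    "\<And>x. subst_mat G (crown_pair n l x) = crown_mat n D x" by blast
  hence "subst_mat (F + G) (crown_pair n l x) = crown_mat n (\<lambda>i j. C i j + D i j) x" for x
    by (subst subst_mat_add[OF add.hyps[THEN alg_X_carrier]])
      (auto simp: crown_mat_def distrib_right)
  thus ?case by blast
next
  case (smult F c)
  then obtain C where "\<And>x. subst_mat F (crown_pair n l x) = crown_mat n C x" by blast
  hence "subst_mat (gconst c \<cdot>\<^sub>m F) (crown_pair n l x) = crown_mat n (\<lambda>i j. c * C i j) x" for x
    by (auto simp: subst_mat_smult crown_mat_def)
  thus ?case by blast
next
  case (mult F G)
  then obtain C D where "\<And>x. subst_mat F (crown_pair n l x) = crown_mat n C x"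
    "\<And>x. subst_mat G (crown_pair n l x) = crown_mat n D x" by blast
  thus ?case
    by (simp add: subst_mat_mult[OF mult.hyps[THEN alg_X_carrier]] crown_mat_mult) blast
qed

section \<open>Independence of the invariants from \<open>x\<close>\<close>

lemma char_poly_crown_mat: "char_poly (crown_mat n C x) = (\<Prod>i\<leftarrow>[0..<n]. [:- C i i, 1:])"
proof -
  \<comment> \<open>Every edge has its row index below 2 and its column index at least 2, so it lies
    above the diagonal.\<close>
  have "upper_triangular (crown_mat n C x)"
    by (auto simp: upper_triangular_def crown_mat_def crown_mask_def crown_def)
  hence "char_poly (crown_mat n C x) = (\<Prod>a\<leftarrow>diag_mat (crown_mat n C x). [:- a, 1:])"
    by (intro char_poly_upper_triangular[of _ n]) auto
  also have "diag_mat (crown_mat n C x) = map (\<lambda>i. C i i) [0..<n]"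
    by (auto simp: diag_mat_def crown_mat_def crown_mask_def)
  finally show ?thesis by (simp add: comp_def)
qed

lemma sigma_crown_mat: "sigma t (crown_mat n C x) = sigma t (crown_mat n C y)"
  by (simp add: sigma_def char_poly_crown_mat) (simp add: crown_mat_def)

text \<open>For nonzero parameters the masks have the same zeros, so each entry vanishes in both
  matrices or in neither.\<close>

lemma zeta_crown_mat:
  assumes "x \<noteq> 0" "y \<noteq> 0"
  shows "zeta (crown_mat n C x) = zeta (crown_mat n C y)"
proof -
  have "crown_mask x i j = 0 \<longleftrightarrow> crown_mask y i j = 0" for i j
    using assms by (auto simp: crown_mask_def crown_def)
  thus ?thesis by (auto simp: zeta_def crown_mat_def mat_eq_iff)
qed

section \<open>Membership in \<open>D_set\<close> and separation of the orbits\<close>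

lemma crown_pair_in_D_set:
  assumes "inj_on l {0..<n}"
  shows "crown_pair n l x \<in> D_set n"
proof -
  \<comment> \<open>In this form the diagonal matrix falls under \<open>char_poly_crown_mat\<close>,
    which yields its eigenvalues.\<close>
  have fst: "fst (crown_pair n l x) = crown_mat n (\<lambda>i j. if i = j then l i else 0) x"
    by (auto simp: crown_pair_def crown_mat_def crown_mask_def)
  have "{k. eigenvalue (fst (crown_pair n l x)) k} = l ` {0..<n}"
    unfolding fst
    by (auto simp: eigenvalue_root_char_poly[OF crown_mat_carrier] char_poly_crown_mat
        poly_prod_list prod_list_zero_iff)
  with assms show ?thesis
    by (simp add: D_set_def card_image) (simp add: crown_pair_def mat_pairs_def)
qed

lemma in_GL_orbit_self:
  fixes A :: "'a::field mat_pair"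
  assumes "A \<in> mat_pairs n"
  shows "A \<in> GL_orbit n A"
proof -
  have "A = (1\<^sub>m n * fst A * 1\<^sub>m n, 1\<^sub>m n * snd A * 1\<^sub>m n)"
    using assms by (cases A) (auto simp: mat_pairs_def)
  moreover have "inverts_mat (1\<^sub>m n) (1\<^sub>m n :: 'a mat)" by (simp add: inverts_mat_def)
  ultimately show ?thesis
    unfolding GL_orbit_def by (intro CollectI exI[of _ "1\<^sub>m n"]) auto
qed

text \<open>The conjugating matrix commutes with a diagonal matrix with distinct entries, so it is
  diagonal and preserves the cross-ratio.\<close>

lemma crown_pair_GL_orbitD:
  assumes "n \<ge> 4" "inj_on l {0..<n}" "crown_pair n l y \<in> GL_orbit n (crown_pair n l x)"
  shows "x = y"
proof -
  define A1 where "A1 = fst (crown_pair n l x)"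
  define A2 where "A2 = snd (crown_pair n l x)"
  define B2 where "B2 = snd (crown_pair n l y)"
  have A1_eq: "A1 = fst (crown_pair n l y)" by (simp add: A1_def crown_pair_def)
  have carr: "A1 \<in> carrier_mat n n" "A2 \<in> carrier_mat n n" "B2 \<in> carrier_mat n n"
    by (auto simp: A1_def A2_def B2_def crown_pair_def)
  obtain g h where gh: "g \<in> carrier_mat n n" "h \<in> carrier_mat n n"
    "inverts_mat g h" "inverts_mat h g" and A1: "A1 = g * A1 * h" and B2: "B2 = g * A2 * h"
    using assms(3) unfolding GL_orbit_def A1_eq A2_def B2_def by (auto simp: A1_def crown_pair_def)
  \<comment> \<open>Multiplying by \<open>g\<close> on the right turns the conjugations into
    intertwining relations without \<open>h\<close>.\<close>
  have cancel: "M * h * g = M" if "M \<in> carrier_mat n n" for M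
    using that gh by (simp add: inverts_mat_def assoc_mult_mat[of M n n h n g n])
  have comm: "A1 * g = g * A1" using cancel[of "g * A1"] A1 carr gh by simp
  have intertw: "B2 * g = g * A2" using cancel[of "g * A2"] B2 carr gh by simp
  have offdiag: "g $$ (i, j) = 0" if "i < n" "j < n" "i \<noteq> j" for i j
  proof -
    have "(A1 * g) $$ (i, j) = l i * g $$ (i, j)" "(g * A1) $$ (i, j) = g $$ (i, j) * l j"
      using that gh by (simp_all add: A1_def crown_pair_def scalar_prod_def if_distrib sum.delta
          if_distribR cong: if_cong)
    hence "l i * g $$ (i, j) = g $$ (i, j) * l j" unfolding comm by (rule trans[OF sym])
    moreover have "l i \<noteq> l j" using assms(2) that by (auto simp: inj_on_def)
    ultimately show ?thesis by (simp add: mult.commute)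
  qed
  have scale: "crown y i j * g $$ (j, j) = g $$ (i, i) * crown x i j" if ij: "i < n" "j < n" for i j
  proof -
    have "(B2 * g) $$ (i, j) = (\<Sum>k<n. crown y i k * g $$ (k, j))"
      using ij gh by (simp add: B2_def crown_pair_def scalar_prod_def lessThan_atLeast0)
    also have "\<dots> = (\<Sum>k\<in>{j}. crown y i k * g $$ (k, j))"
      using ij offdiag by (intro sum.mono_neutral_right) auto
    finally have l: "(B2 * g) $$ (i, j) = crown y i j * g $$ (j, j)" by simp
    have "(g * A2) $$ (i, j) = (\<Sum>k<n. g $$ (i, k) * crown x k j)"
      using ij gh by (simp add: A2_def crown_pair_def scalar_prod_def lessThan_atLeast0)
    also have "\<dots> = (\<Sum>k\<in>{i}. g $$ (i, k) * crown x k j)"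
      using ij offdiag by (intro sum.mono_neutral_right) auto
    finally show ?thesis using l intertw by simp
  qed
  \<comment> \<open>The three edges with entry 1 force the first four diagonal entries of
    \<open>g\<close> to agree; the fourth edge then compares \<open>x\<close> with
    \<open>y\<close>.\<close>
  have "g $$ (3, 3) = g $$ (0, 0)" "g $$ (2, 2) = g $$ (0, 0)" "g $$ (2, 2) = g $$ (1, 1)"
    "y * g $$ (3, 3) = g $$ (1, 1) * x"
    using scale[of 0 3] scale[of 0 2] scale[of 1 2] scale[of 1 3] assms(1)
    by (simp_all add: crown_def)
  hence eq: "y * g $$ (3, 3) = x * g $$ (3, 3)" by simp
  have "1 = (g * h) $$ (3, 3)" using gh assms(1) by (simp add: inverts_mat_def)
  also have "\<dots> = (\<Sum>k<n. g $$ (3, k) * h $$ (k, 3))"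
    using gh assms(1) by (simp add: scalar_prod_def lessThan_atLeast0)
  also have "\<dots> = (\<Sum>k\<in>{3}. g $$ (3, k) * h $$ (k, 3))"
    using assms(1) offdiag by (intro sum.mono_neutral_right) auto
  finally have "g $$ (3, 3) \<noteq> 0" by auto
  with eq show ?thesis by simp
qed

theorem lemma5p2:
  fixes n :: nat
  assumes "n \<ge> 4"
    and "\<exists>T :: 'a::field set. finite T \<and> card T = n"
  shows "\<not> separates_GL_orbits n (all_sigma_zeta n) (D_set n :: 'a mat_pair set)
    \<and> (\<exists>A \<in> (D_set n :: 'a mat_pair set). \<exists>B \<in> D_set n. GL_orbit n A \<noteq> GL_orbit n B \<and>
          (\<forall>t \<in> {1..n}. \<forall>F \<in> alg_X n. sigma t (subst_mat F A) = sigma t (subst_mat F B)) \<and>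
          (\<forall>F \<in> alg_X n. zeta (subst_mat F A) = zeta (subst_mat F B)))
    \<and> \<not> separates_GL_orbits n (Set_sigma n \<union> Set_zeta n) (D_set n :: 'a mat_pair set)"
proof -
  obtain T :: "'a set" where T: "finite T" "card T = n" using assms(2) by blast
  then obtain l where "bij_betw l {0..<n} T" using ex_bij_betw_nat_finite by blast
  hence inj: "inj_on l {0..<n}" by (simp add: bij_betw_def)
  \<comment> \<open>The value \<open>x \<noteq> 0\<close> keeps the support of the second matrix,
    and \<open>x \<noteq> 1\<close> changes the cross-ratio.\<close>
  have "\<not> T \<subseteq> {0, 1}"
    using card_mono[of "{0, 1 :: 'a}" T] assms(1) T by auto
  then obtain x :: 'a where x: "x \<noteq> 0" "x \<noteq> 1" by blast
  let ?A = "crown_pair n l 1" and ?B = "crown_pair n l x"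
  have D: "?A \<in> D_set n" "?B \<in> D_set n" using inj by (simp_all add: crown_pair_in_D_set)
  \<comment> \<open>If the orbits were equal, \<open>?B\<close> would lie in the orbit of
    \<open>?A\<close>, forcing \<open>1 = x\<close>.\<close>
  have "?B \<in> GL_orbit n ?B" using D by (auto simp: D_set_def intro: in_GL_orbit_self)
  hence orbit: "GL_orbit n ?A \<noteq> GL_orbit n ?B"
    using crown_pair_GL_orbitD[OF assms(1) inj, of x 1] x by auto
  have inv: "sigma t (subst_mat F ?A) = sigma t (subst_mat F ?B)"
    "zeta (subst_mat F ?A) = zeta (subst_mat F ?B)" if F: "F \<in> alg_X n" for t F
  proof -
    obtain C where C: "\<And>z. subst_mat F (crown_pair n l z) = crown_mat n C z"
      using subst_mat_crown_pair[OF F] by blast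
    show "sigma t (subst_mat F ?A) = sigma t (subst_mat F ?B)"
      unfolding C by (rule sigma_crown_mat)
    show "zeta (subst_mat F ?A) = zeta (subst_mat F ?B)"
      unfolding C using x by (intro zeta_crown_mat) auto
  qed
  \<comment> \<open>Stated for arbitrary subsets so as to cover the full set of invariants and
    \<open>Set_sigma n \<union> Set_zeta n\<close> alike.\<close>
  have not_sep: "\<not> separates_GL_orbits n S (D_set n :: 'a mat_pair set)"
    if "S \<subseteq> all_sigma_zeta n" for S
  proof -
    have "f ?A = f ?B" if "f \<in> all_sigma_zeta n" for f
      using that inv by (auto simp: all_sigma_zeta_def sigma_inv_def zeta_inv_def)
    thus ?thesis using D orbit \<open>S \<subseteq> _\<close> unfolding separates_GL_orbits_def by blast
  qed
  have "Set_sigma n \<union> Set_zeta n \<subseteq> all_sigma_zeta n"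
    unfolding Set_sigma_def Set_zeta_def all_sigma_zeta_def using alg_X.generic by blast
  with not_sep D orbit inv show ?thesis by blast
qed

end
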